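(* Let $n,m$ be positive odd integers. There exists a generalized $(n\times m,\{3,4\},1)$-PDF if and only if $nm\equiv 1\pmod 6$.
   Context: For an odd positive integer $n$, $[n]$ denotes the set of integers $\{-\frac{n-1}{2},-\frac{n-1}{2}+1,\dots,\frac{n-1}{2}\}$. For a finite set $B\subset\mathbb{Z}\times\mathbb{Z}$, $\Delta B$ is the multiset of differences $(x_1-x_2,y_1-y_2)$ over ordered pairs of distinct elements $(x_1,y_1)\neq(x_2,y_2)$ of $B$ (differences are taken in $\mathbb{Z}\times\mathbb{Z}$, not modulo anything). Let $n,m$ be odd positive integers and $K$ a set of positive integers. A generalized $(n\times m,K,1)$-perfect difference family (PDF) is a finite (possibly empty) collection $\mathcal{B}$ of subsets (base blocks) of $[n]\times[m]$, each with cardinality in $K$, such that the multiset union $\Delta\mathcal{B}=\bigcup_{B\in\mathcal{B}}\Delta B$ contains each element of $([n]\times[m])\setminus\{(0,0)\}$ exactly once and contains nothing else. Not every element of $K$ needs to occur as a block size. *)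

theory Defs
  imports Main "HOL-Library.Multiset" "HOL-Library.Product_Plus" "HOL-Number_Theory.Cong"
begin

text \<open>The symmetric integer interval \<open>[n]\<close>; the division is exact for odd \<open>n\<close>.\<close>

definition centered :: "nat \<Rightarrow> int set" where
  "centered n = {- ((int n - 1) div 2) .. (int n - 1) div 2}"

text \<open>Ordered pairs of distinct points; subtraction is componentwise in the group of integer
  pairs, with no reduction modulo anything. Only meaningful for finite \<open>B\<close>, since
  \<^const>\<open>mset_set\<close> sends infinite sets to the empty multiset.\<close>

definition differences :: "(int \<times> int) set \<Rightarrow> (int \<times> int) multiset" where
  "differences B = {# p - q. (p, q) \<in># mset_set {(p, q). p \<in> B \<and> q \<in> B \<and> p \<noteq> q} #}"

definition family_differences :: "(int \<times> int) set multiset \<Rightarrow> (int \<times> int) multiset" where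
  "family_differences \<B> = (\<Sum>B\<in>#\<B>. differences B)"

text \<open>A generalized \<open>(n \<times> m, K, 1)\<close>-perfect difference family. The collection of base blocks is
  a finite multiset, so an a priori repeated block would contribute its differences repeatedly.
  The multiset equation says that every nonzero grid point occurs exactly once as a difference
  and that nothing else occurs.\<close>

definition generalized_PDF ::
    "nat \<Rightarrow> nat \<Rightarrow> nat set \<Rightarrow> (int \<times> int) set multiset \<Rightarrow> bool" where
  "generalized_PDF n m K \<B> \<longleftrightarrow>
     (\<forall>B \<in># \<B>. B \<subseteq> centered n \<times> centered m \<and> card B \<in> K) \<and>
     family_differences \<B> = mset_set (centered n \<times> centered m - {(0, 0)})"

end

(* A block with differences D is only relevant through D, so the task is to partition the nonzero
   grid points into difference sets of blocks of size 3 or 4. Write n = 2p+1 and m = 2q+1.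

   If p and q are divisible by 3, each axis is partitioned separately: Skolem-type lists partition
   {1..p} into triples {a, b, a+b} when p/3 is 0 or 1 mod 4, and otherwise the single block
   {0, 1, b+1, b+3} with differences 1, 2, b, b+1, b+2, b+3 (where b+3 = p) is split off first
   and a Langford-type list partitions {3..b-1}. Two blocks (x_i) and
   (y_j) on the axes yield the blocks {(x_i, y_s(i))}, s ranging over a sharply 2-transitive set of
   permutations; their differences fill diffs X * diffs Y exactly once.

   If p and q are 2 mod 3, one partitions {1..p} minus a pair {x, 2x} into triples {a, b, a+b}. The
   rows a, b, a+b of the grid are covered by the triples (a,u), (b,v), (a+b,u+v), where u -> v and
   u -> u+v are permutations of the whole row. Only the rows 0, x, 2x, -x, -2x remain; the same
   reduction of the columns leaves a scaled 5 * 5 grid. The value p = 5, which admits no such pair,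
   is left unreduced, so that the 5 * 11 and 11 * 11 grids are needed as well. *)
theory Submission
  imports Defs
begin

section \<open>Partitions into difference sets\<close>

definition diffs :: "'a::ab_group_add set \<Rightarrow> 'a set" where
  "diffs B = {x - y | x y. x \<in> B \<and> y \<in> B \<and> x \<noteq> y}"

lemma diffsI: "x \<in> B \<Longrightarrow> y \<in> B \<Longrightarrow> x \<noteq> y \<Longrightarrow> x - y \<in> diffs B"
  unfolding diffs_def by blast

lemma diffsE:
  assumes "d \<in> diffs B"
  obtains x y where "x \<in> B" "y \<in> B" "x \<noteq> y" "d = x - y"
  using assms unfolding diffs_def by blast

text \<open>Guards multiplicities: under this condition the plain set \<open>diffs B\<close> carries
  the whole multiset of differences.\<close>

definition distinct_diffs :: "'a::ab_group_add set \<Rightarrow> bool" where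
  "distinct_diffs B \<longleftrightarrow>
     (\<forall>x\<in>B. \<forall>y\<in>B. \<forall>u\<in>B. \<forall>v\<in>B. x \<noteq> y \<longrightarrow> u \<noteq> v \<longrightarrow> x - y = u - v \<longrightarrow> x = u \<and> y = v)"

lemma distinct_diffsD:
  "distinct_diffs B \<Longrightarrow> x \<in> B \<Longrightarrow> y \<in> B \<Longrightarrow> u \<in> B \<Longrightarrow> v \<in> B \<Longrightarrow> x \<noteq> y \<Longrightarrow> x - y = u - v \<Longrightarrow>
     x = u \<and> y = v"
  unfolding distinct_diffs_def by (metis right_minus_eq)

text \<open>The blocks are forgotten, so they may be translated or mapped freely; the disjointness
  premise makes every element arise from exactly one block.\<close>

inductive decomposable :: "nat set \<Rightarrow> 'a::ab_group_add set \<Rightarrow> bool" for K where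
  empty: "decomposable K {}"
| block: "decomposable K D \<Longrightarrow> finite B \<Longrightarrow> card B \<in> K \<Longrightarrow> distinct_diffs B \<Longrightarrow> D \<inter> diffs B = {} \<Longrightarrow>
     decomposable K (diffs B \<union> D)"

lemma decomposable_diffs:
  "finite B \<Longrightarrow> card B \<in> K \<Longrightarrow> distinct_diffs B \<Longrightarrow> decomposable K (diffs B)"
  using decomposable.block[OF decomposable.empty, of B K] by simp

lemma decomposable_Un:
  assumes "decomposable K A" "decomposable K C" "A \<inter> C = {}"
  shows "decomposable K (A \<union> C)"
  using assms(1,3)
proof (induction A)
  case empty
  then show ?case using assms(2) by simp
next
  case (block D B)
  have "decomposable K (diffs B \<union> (D \<union> C))"
    using block by (intro decomposable.block) auto
  then show ?case by (simp add: Un_assoc)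
qed

lemma decomposable_UN:
  assumes "finite I" "\<And>i. i \<in> I \<Longrightarrow> decomposable K (D i)"
    and "\<And>i j. i \<in> I \<Longrightarrow> j \<in> I \<Longrightarrow> D i \<inter> D j \<noteq> {} \<Longrightarrow> i = j"
  shows "decomposable K (\<Union>i\<in>I. D i)"
  using assms
proof (induction I)
  case empty
  then show ?case by (simp add: decomposable.empty)
next
  case (insert i I)
  have "D i \<inter> (\<Union>j\<in>I. D j) = {}"
    using insert.prems(2)[of i] insert.hyps(2) by blast
  moreover have "decomposable K (\<Union>j\<in>I. D j)"
    using insert by blast
  ultimately show ?case
    using decomposable_Un[of K "D i" "\<Union>j\<in>I. D j"] insert.prems(1) by simp
qed

lemma decomposable_mono:
  assumes "decomposable K A" "K \<subseteq> K'"
  shows "decomposable K' A"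
  using assms by (induction A) (auto intro: decomposable.intros)

lemma diffs_image:
  fixes f :: "'a::ab_group_add \<Rightarrow> 'b::ab_group_add"
  assumes "\<And>x y. f (x - y) = f x - f y" "inj f"
  shows "diffs (f ` B) = f ` diffs B"
proof (intro set_eqI iffI)
  fix d
  assume "d \<in> diffs (f ` B)"
  then obtain x y where "x \<in> B" "y \<in> B" "f x \<noteq> f y" "d = f (x - y)"
    by (auto simp: diffs_def assms(1))
  then show "d \<in> f ` diffs B"
    by (auto simp: diffs_def)
next
  fix d
  assume "d \<in> f ` diffs B"
  then obtain x y where "x \<in> B" "y \<in> B" "x \<noteq> y" "d = f x - f y"
    by (auto simp: diffs_def assms(1))
  then show "d \<in> diffs (f ` B)"
    using injD[OF assms(2)] unfolding diffs_def by blast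
qed

text \<open>Serves for exchanging coordinates, stretching a grid and embedding an axis.\<close>

lemma decomposable_image:
  fixes f :: "'a::ab_group_add \<Rightarrow> 'b::ab_group_add"
  assumes f: "\<And>x y. f (x - y) = f x - f y" "inj f" and "decomposable K A"
  shows "decomposable K (f ` A)"
  using assms(3)
proof (induction A)
  case empty
  then show ?case by (simp add: decomposable.empty)
next
  case (block D B)
  have "distinct_diffs (f ` B)"
    unfolding distinct_diffs_def
  proof (intro ballI impI)
    fix x' y' u' v'
    assume "x' \<in> f ` B" "y' \<in> f ` B" "u' \<in> f ` B" "v' \<in> f ` B" and ne: "x' \<noteq> y'" and eq: "x' - y' = u' - v'"
    then obtain x y u v where xy: "x \<in> B" "y \<in> B" "u \<in> B" "v \<in> B"
        "x' = f x" "y' = f y" "u' = f u" "v' = f v"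
      by blast
    then have "f (x - y) = f (u - v)"
      using eq by (simp only: f(1))
    then have "x - y = u - v"
      by (rule injD[OF f(2)])
    then have "x = u \<and> y = v"
      using distinct_diffsD[OF block.hyps(4) xy(1-4)] ne xy by blast
    then show "x' = u' \<and> y' = v'"
      using xy by simp
  qed
  moreover have "f ` D \<inter> diffs (f ` B) = {}"
    using block.hyps(5) injD[OF f(2)] unfolding diffs_image[OF f] by blast
  moreover have "card (f ` B) \<in> K"
    using block.hyps(3) f(2) by (metis card_image inj_on_subset subset_UNIV)
  ultimately have "decomposable K (diffs (f ` B) \<union> f ` D)"
    using block by (intro decomposable.block) simp_all
  then show ?case
    by (simp only: image_Un diffs_image[OF f])
qed

section \<open>Explicit blocks and zero-sum triples\<close>

lemma diffs_3:
  assumes "x \<noteq> y" "y \<noteq> z" "z \<noteq> x"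
  shows "diffs {x, y, z} = {x - y, y - z, z - x, y - x, z - y, x - z}"
  using assms unfolding diffs_def by blast

text \<open>An evaluable form of \<open>diffs\<close> that keeps repetitions, so that distinctness
  of this list certifies \<open>distinct_diffs\<close>.\<close>

definition diff_list :: "'a::ab_group_add list \<Rightarrow> 'a list" where
  "diff_list bs = map (\<lambda>(x, y). x - y) (filter (\<lambda>(x, y). x \<noteq> y) (List.product bs bs))"

lemma diffs_set: "diffs (set bs) = set (diff_list bs)"
  by (auto simp: diffs_def diff_list_def)

lemma distinct_diffs_set:
  assumes "distinct (diff_list bs)"
  shows "distinct_diffs (set bs)"
proof -
  have inj: "inj_on (\<lambda>(x, y). x - y) (set (filter (\<lambda>(x, y). x \<noteq> y) (List.product bs bs)))"
    using assms unfolding diff_list_def distinct_map by blast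
  show ?thesis
    unfolding distinct_diffs_def
  proof (intro ballI impI)
    fix x y u v
    assume "x \<in> set bs" "y \<in> set bs" "u \<in> set bs" "v \<in> set bs" "x \<noteq> y" "u \<noteq> v" "x - y = u - v"
    then have "(x, y) = (u, v)"
      by (intro inj_onD[OF inj]) simp_all
    then show "x = u \<and> y = v"
      by simp
  qed
qed

text \<open>Realised by the block \<open>{0, a, a + b}\<close>, since
  \<open>a + b = - c\<close>.\<close>

lemma decomposable_triple:
  fixes a b c :: "'a::ab_group_add"
  assumes "a + b + c = 0" "distinct [a, b, c, - a, - b, - c]" "3 \<in> K"
  shows "decomposable K {a, b, c, - a, - b, - c}"
proof -
  have "a + b = - c"
    using assms(1) by (metis eq_neg_iff_add_eq_0)
  then have c: "(a + b) - 0 = - c" "0 - (a + b) = c"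
    by simp_all
  have ab: "a - 0 = a" "0 - a = - a" "a + b - a = b" "a - (a + b) = - b"
    by simp_all
  have nz: "0 \<noteq> a" "a \<noteq> a + b" "0 \<noteq> a + b" "a + b \<noteq> 0"
    using assms(1,2) by auto
  then have "diff_list [0, a, a + b] =
      [0 - a, 0 - (a + b), a - 0, a - (a + b), (a + b) - 0, a + b - a]"
    by (simp add: diff_list_def)
  then have list: "diff_list [0, a, a + b] = [- a, c, a, - b, - c, b]"
    unfolding c ab .
  have "distinct (diff_list [0, a, a + b])"
    unfolding list using assms(2) by auto
  then have "distinct_diffs {0, a, a + b}"
    using distinct_diffs_set by fastforce
  moreover from nz have "card {0, a, a + b} = 3"
    by auto
  ultimately have "decomposable K (diffs {0, a, a + b})"
    using assms(3) by (intro decomposable_diffs) (simp_all add: numeral_3_eq_3)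
  moreover have "diffs {0, a, a + b} = {a, b, c, - a, - b, - c}"
    using diffs_set[of "[0, a, a + b]"] unfolding list by auto
  ultimately show ?thesis
    by simp
qed

text \<open>Converse of \<open>decomposable_triple\<close>: the cyclic differences
  \<open>x - y\<close>, \<open>y - z\<close>, \<open>z - x\<close> sum to zero.\<close>

lemma card_3_diffs:
  fixes B :: "'a::ab_group_add set"
  assumes "card B = 3" "distinct_diffs B"
  obtains a b c where "a + b + c = 0" "distinct [a, b, c, - a, - b, - c]"
    "diffs B = {a, b, c, - a, - b, - c}"
proof -
  obtain x y z where B: "B = {x, y, z}" "x \<noteq> y" "x \<noteq> z" "y \<noteq> z"
    using assms(1) by (auto simp: card_Suc_eq numeral_3_eq_3)
  have d: "p - q \<noteq> u - v"
    if "p \<in> {x, y, z}" "q \<in> {x, y, z}" "u \<in> {x, y, z}" "v \<in> {x, y, z}" "p \<noteq> q" "p \<noteq> u \<or> q \<noteq> v"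
    for p q u v
    using distinct_diffsD[OF assms(2), of p q u v] that B(1) by blast
  show ?thesis
  proof
    show "(x - y) + (y - z) + (z - x) = 0" by simp
    show "diffs B = {x - y, y - z, z - x, - (x - y), - (y - z), - (z - x)}"
      using B by (auto simp: diffs_3)
    show "distinct [x - y, y - z, z - x, - (x - y), - (y - z), - (z - x)]"
      using B(2-) d by simp
  qed
qed

section \<open>Products\<close>

text \<open>Entry \<open>i < k\<close> of a list is the image of \<open>i\<close>. For
  \<open>k = l\<close> the lists are permutations; for \<open>k < l\<close> their first
  \<open>k\<close> entries are injections with the same exactly-once property for pairs.\<close>

definition sharply_2_transitive :: "nat \<Rightarrow> nat \<Rightarrow> nat list list \<Rightarrow> bool" where
  "sharply_2_transitive k l ps \<longleftrightarrow>
     (\<forall>p\<in>set ps. \<forall>i<k. p ! i < l \<and> (\<forall>j<k. i \<noteq> j \<longrightarrow> p ! i \<noteq> p ! j)) \<and>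
     (\<forall>i<k. \<forall>j<k. \<forall>u<l. \<forall>v<l. i \<noteq> j \<longrightarrow> u \<noteq> v \<longrightarrow> (\<exists>p\<in>set ps. p ! i = u \<and> p ! j = v)) \<and>
     (\<forall>p\<in>set ps. \<forall>q\<in>set ps. \<forall>i<k. \<forall>j<k.
        i \<noteq> j \<longrightarrow> p ! i = q ! i \<longrightarrow> p ! j = q ! j \<longrightarrow> p = q)"

definition perms3 :: "nat list list" where
  "perms3 =
  [[0, 1, 2], [0, 2, 1], [1, 0, 2], [1, 2, 0], [2, 0, 1], [2, 1, 0]]"

definition even_perms4 :: "nat list list" where
  "even_perms4 =
  [[0, 1, 2, 3], [0, 2, 3, 1], [0, 3, 1, 2], [1, 0, 3, 2], [1, 2, 0, 3], [1, 3, 2, 0],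
   [2, 0, 1, 3], [2, 1, 3, 0], [2, 3, 0, 1], [3, 0, 2, 1], [3, 1, 0, 2], [3, 2, 1, 0]]"

lemma sharply_2_transitive_perms3: "sharply_2_transitive 3 3 perms3"
  by (simp add: sharply_2_transitive_def perms3_def All_less_Suc numeral_eq_Suc)

text \<open>The alternating group on four points is sharply 2-transitive; any two entries determine
  the permutation, so three of them suffice for blocks of size 3.\<close>

lemma sharply_2_transitive_even_perms4:
  "sharply_2_transitive 3 4 even_perms4" "sharply_2_transitive 4 4 even_perms4"
  by (simp_all add: sharply_2_transitive_def even_perms4_def All_less_Suc numeral_eq_Suc)

text \<open>A difference of two points of a block reveals their positions through the first
  coordinate and their values through the second, hence the permutation. Transitivity provides every
  pair of differences.\<close>

lemma decomposable_diffs_times_diffs: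
  fixes B :: "'a::ab_group_add set" and C :: "'b::ab_group_add set"
  assumes B: "finite B" "card B = k" "distinct_diffs B"
    and C: "finite C" "card C = l" "distinct_diffs C"
    and ps: "sharply_2_transitive k l ps" and "k \<in> K"
  shows "decomposable K (diffs B \<times> diffs C)"
proof -
  obtain f where f: "bij_betw f {..<k} B"
    using ex_bij_betw_nat_finite[OF B(1)] B(2) by (auto simp: atLeast0LessThan)
  obtain g where g: "bij_betw g {..<l} C"
    using ex_bij_betw_nat_finite[OF C(1)] C(2) by (auto simp: atLeast0LessThan)
  have fB: "f i \<in> B" if "i < k" for i
    using f that by (auto simp: bij_betw_def)
  have gC: "g i \<in> C" if "i < l" for i
    using g that by (auto simp: bij_betw_def)
  have f_eq: "f i = f j \<longleftrightarrow> i = j" if "i < k" "j < k" for i j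
    using f that by (auto simp: bij_betw_def inj_on_def)
  have g_eq: "g i = g j \<longleftrightarrow> i = j" if "i < l" "j < l" for i j
    using g that by (auto simp: bij_betw_def inj_on_def)
  have f_diff: "i = u \<and> j = v"
    if "f i - f j = f u - f v" and less: "i < k" "j < k" "u < k" "v < k" and "i \<noteq> j" for i j u v
  proof -
    have "f i = f u \<and> f j = f v"
      using that f_eq by (intro distinct_diffsD[OF B(3)] fB) blast+
    then show ?thesis
      using f_eq less by blast
  qed
  have g_diff: "i = u \<and> j = v"
    if "g i - g j = g u - g v" and less: "i < l" "j < l" "u < l" "v < l" and "i \<noteq> j" for i j u v
  proof -
    have "g i = g u \<and> g j = g v"
      using that g_eq by (intro distinct_diffsD[OF C(3)] gC) blast+
    then show ?thesis
      using g_eq less by blast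
  qed
  note ps' = ps[unfolded sharply_2_transitive_def]
  note ps_less = conjunct1[OF ps']
  note ps_ex = conjunct1[OF conjunct2[OF ps']]
  note ps_unique = conjunct2[OF conjunct2[OF ps']]
  define h where "h p i = (f i, g (p ! i))" for p i
  have h_eq: "h p i = h p j \<longleftrightarrow> i = j" if "i < k" "j < k" for p i j
    using f_eq[OF that] unfolding h_def by auto
  \<comment> \<open>One uniqueness statement for two purposes: distinct differences within a block
    and disjointness of different blocks.\<close>
  have h_diff: "i = u \<and> j = v \<and> p = q"
    if eq: "h p i - h p j = h q u - h q v" and ne: "i \<noteq> j"
      and less: "i < k" "j < k" "u < k" "v < k" and p: "p \<in> set ps" and q: "q \<in> set ps"
    for p q i j u v
  proof -
    have "i = u \<and> j = v"
      using eq less ne by (intro f_diff) (auto simp: h_def)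
    moreover have "p ! i = q ! u \<and> p ! j = q ! v"
      using eq less ne p q ps_less by (intro g_diff) (auto simp: h_def)
    ultimately show ?thesis
      using ps_unique less ne p q by blast
  qed
  define H where "H p = h p ` {..<k}" for p
  have diffs_H: "z \<in> diffs (H p) \<longleftrightarrow> (\<exists>i j. i < k \<and> j < k \<and> i \<noteq> j \<and> z = h p i - h p j)" for z p
  proof
    assume "z \<in> diffs (H p)"
    then show "\<exists>i j. i < k \<and> j < k \<and> i \<noteq> j \<and> z = h p i - h p j"
      by (elim diffsE) (unfold H_def, blast)
  next
    assume "\<exists>i j. i < k \<and> j < k \<and> i \<noteq> j \<and> z = h p i - h p j"
    then obtain i j where ij: "i < k" "j < k" "i \<noteq> j" "z = h p i - h p j"
      by blast
    then show "z \<in> diffs (H p)"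
      unfolding ij(4) H_def using h_eq by (intro diffsI imageI) simp_all
  qed
  have "diffs B \<times> diffs C = (\<Union>p\<in>set ps. diffs (H p))"
  proof (intro set_eqI iffI)
    fix z
    assume "z \<in> diffs B \<times> diffs C"
    then obtain b c where z: "z = (b, c)" "b \<in> diffs B" "c \<in> diffs C"
      by blast
    obtain i j where ij: "i < k" "j < k" "f i \<noteq> f j" "b = f i - f j"
      using z(2) f unfolding bij_betw_def by (elim diffsE) blast
    obtain u v where uv: "u < l" "v < l" "g u \<noteq> g v" "c = g u - g v"
      using z(3) g unfolding bij_betw_def by (elim diffsE) blast
    have ne: "i \<noteq> j" "u \<noteq> v"
      using ij(3) uv(3) by blast+
    then obtain p where p: "p \<in> set ps" "p ! i = u" "p ! j = v"
      using ps_ex ij(1,2) uv(1,2) by blast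
    have "z = h p i - h p j"
      unfolding z ij(4) uv(4) h_def p by simp
    then show "z \<in> (\<Union>p\<in>set ps. diffs (H p))"
      using p(1) diffs_H ij(1,2) ne(1) by blast
  next
    fix z
    assume "z \<in> (\<Union>p\<in>set ps. diffs (H p))"
    then obtain p i j where p: "p \<in> set ps" and ij: "i < k" "j < k" "i \<noteq> j" and z: "z = h p i - h p j"
      using diffs_H by blast
    have "f i - f j \<in> diffs B"
      using ij fB f_eq by (intro diffsI) blast+
    moreover have "g (p ! i) - g (p ! j) \<in> diffs C"
      using ij p ps_less gC g_eq by (intro diffsI) blast+
    ultimately show "z \<in> diffs B \<times> diffs C"
      unfolding z h_def by simp
  qed
  moreover have "decomposable K (\<Union>p\<in>set ps. diffs (H p))"
  proof (rule decomposable_UN)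
    fix p
    assume p: "p \<in> set ps"
    have "card (H p) = k"
      unfolding H_def by (subst card_image) (auto simp: inj_on_def h_eq)
    moreover have "distinct_diffs (H p)"
      unfolding distinct_diffs_def H_def
    proof (intro ballI impI, elim imageE)
      fix x y u v i j i' j'
      assume "x \<noteq> y" "x - y = u - v" and x: "x = h p i" "y = h p j" "u = h p i'" "v = h p j'"
        and "i \<in> {..<k}" "j \<in> {..<k}" "i' \<in> {..<k}" "j' \<in> {..<k}"
      then have "i = i' \<and> j = j' \<and> p = p"
        using p by (intro h_diff) auto
      then show "x = u \<and> y = v"
        using x by blast
    qed
    ultimately show "decomposable K (diffs (H p))"
      using \<open>k \<in> K\<close> by (intro decomposable_diffs) (simp_all add: H_def)
  next
    fix p q
    assume p: "p \<in> set ps" and q: "q \<in> set ps" and "diffs (H p) \<inter> diffs (H q) \<noteq> {}"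
    then obtain i j u v where "i < k" "j < k" "i \<noteq> j" "u < k" "v < k" "h p i - h p j = h q u - h q v"
      using diffs_H by fastforce
    then show "p = q"
      using h_diff p q by blast
  qed simp
  ultimately show ?thesis
    by simp
qed

lemma decomposable_swap:
  fixes D :: "('a::ab_group_add \<times> 'b::ab_group_add) set"
  assumes "decomposable K D"
  shows "decomposable K (prod.swap ` D)"
  using assms by (rule decomposable_image[rotated 2]) (auto simp: prod.swap_def)

lemma decomposable_diffs_times_diffs_34:
  fixes B :: "'a::ab_group_add set" and C :: "'b::ab_group_add set"
  assumes B: "finite B" "card B \<in> {3, 4}" "distinct_diffs B"
    and C: "finite C" "card C \<in> {3, 4}" "distinct_diffs C"
  shows "decomposable {3, 4} (diffs B \<times> diffs C)"
proof -
  consider "card B = 3" "card C = 3" | "card B = 3" "card C = 4" | "card B = 4" "card C = 3" |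
    "card B = 4" "card C = 4"
    using B(2) C(2) by auto
  then show ?thesis
  proof cases
    \<comment> \<open>Four positions cannot be injected into three values, so the factors exchange
      roles.\<close>
    case 3
    have "decomposable {3, 4} (diffs C \<times> diffs B)"
      using decomposable_diffs_times_diffs[OF C(1) 3(2) C(3) B(1) 3(1) B(3) sharply_2_transitive_even_perms4(1)]
      by simp
    then show ?thesis
      using decomposable_swap by (metis product_swap)
  qed (use decomposable_diffs_times_diffs[OF B(1) _ B(3) C(1) _ C(3)] sharply_2_transitive_perms3
      sharply_2_transitive_even_perms4 in blast)+
qed

lemma decomposable_times:
  fixes A :: "'a::ab_group_add set" and C :: "'b::ab_group_add set"
  assumes "decomposable {3, 4} A" "decomposable {3, 4} C"
  shows "decomposable {3, 4} (A \<times> C)"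
  using assms(1)
proof (induction A)
  case empty
  then show ?case by (simp add: decomposable.empty)
next
  case (block A B)
  from assms(2) have "decomposable {3, 4} (diffs B \<times> C)"
  proof (induction C)
    case empty
    then show ?case by (simp add: decomposable.empty)
  next
    case C: (block C B')
    have "decomposable {3, 4} (diffs B \<times> diffs B' \<union> diffs B \<times> C)"
      using C.IH C.hyps block.hyps
      by (intro decomposable_Un decomposable_diffs_times_diffs_34) auto
    then show ?case by (simp add: Sigma_Un_distrib2)
  qed
  then have "decomposable {3, 4} (diffs B \<times> C \<union> A \<times> C)"
    using block by (intro decomposable_Un) auto
  then show ?case by (simp add: Sigma_Un_distrib1)
qed

section \<open>Rows over a zero-sum triple\<close>

text \<open>For \<open>u = 2k - q\<close> the values of this map and of its sum with \<open>u\<close> are \<open>-k\<close> and \<open>k - q\<close>; for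
  \<open>u = 2k + 1 - q\<close> they are \<open>q - k\<close> and \<open>k + 1\<close>.\<close>

definition additive_perm :: "int \<Rightarrow> int \<Rightarrow> int" where
  "additive_perm q u = (if even (u + q) then - ((u + q) div 2) else q - (u + q) div 2)"

lemma additive_perm_cases:
  obtains k where "u = 2 * k - q" "additive_perm q u = - k"
  | k where "u = 2 * k + 1 - q" "additive_perm q u = q - k"
proof (cases "even (u + q)")
  case True
  then obtain k where "u + q = 2 * k" by (rule evenE)
  then show ?thesis using that(1)[of k] by (simp add: additive_perm_def eq_diff_eq)
next
  case False
  then obtain k where "u + q = 2 * k + 1" by (rule oddE)
  then show ?thesis using that(2)[of k] by (simp add: additive_perm_def eq_diff_eq)
qed

text \<open>The parity classes of \<open>u + q\<close> have disjoint ranges: the values lie in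
  \<open>- q..0\<close> for even and in \<open>1..q\<close> for odd \<open>u + q\<close>.
  Injectivity suffices on a finite interval.\<close>

lemma bij_betw_additive_perm: "bij_betw (additive_perm q) {- q..q} {- q..q}"
proof -
  have "inj_on (additive_perm q) {- q..q}"
  proof (rule inj_onI)
    fix x y
    assume "x \<in> {- q..q}" "y \<in> {- q..q}" "additive_perm q x = additive_perm q y"
    then show "x = y"
      by (cases q x rule: additive_perm_cases; cases q y rule: additive_perm_cases) auto
  qed
  moreover have "additive_perm q x \<in> {- q..q}" if "x \<in> {- q..q}" for x
    using that by (cases q x rule: additive_perm_cases) auto
  ultimately show ?thesis
    by (simp add: bij_betw_def endo_inj_surj image_subset_iff)
qed

text \<open>The unnegated sums again lie in \<open>- q..0\<close> for even and in
  \<open>1..q\<close> for odd \<open>u + q\<close>. The sign prepares zero-sum triples.\<close>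

lemma bij_betw_additive_perm_sum: "bij_betw (\<lambda>u. - (u + additive_perm q u)) {- q..q} {- q..q}"
proof -
  have "inj_on (\<lambda>u. - (u + additive_perm q u)) {- q..q}"
  proof (rule inj_onI)
    fix x y
    assume "x \<in> {- q..q}" "y \<in> {- q..q}" "- (x + additive_perm q x) = - (y + additive_perm q y)"
    then show "x = y"
      by (cases q x rule: additive_perm_cases; cases q y rule: additive_perm_cases) auto
  qed
  moreover have "- (x + additive_perm q x) \<in> {- q..q}" if "x \<in> {- q..q}" for x
    using that by (cases q x rule: additive_perm_cases) auto
  ultimately show ?thesis
    by (simp add: bij_betw_def endo_inj_surj image_subset_iff)
qed

text \<open>The points \<open>(a, u)\<close>, \<open>(b, v u)\<close>, \<open>(c, w u)\<close> sum
  to zero, so with their negatives they form a difference set \<open>D u\<close>. As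
  \<open>u\<close> runs through the interval, each of the six rows is swept exactly once.\<close>

lemma decomposable_triple_times_interval:
  fixes a b c :: "'a::ab_group_add" and q :: int
  assumes abc: "a + b + c = 0" "distinct [a, b, c, - a, - b, - c]"
  shows "decomposable {3} ({a, b, c, - a, - b, - c} \<times> {- q..q})"
proof -
  define v where "v = additive_perm q"
  define w where "w u = - (u + v u)" for u
  have v: "bij_betw v {- q..q} {- q..q}" and w: "bij_betw w {- q..q} {- q..q}"
    unfolding v_def w_def by (rule bij_betw_additive_perm bij_betw_additive_perm_sum)+
  define D where "D u = {(a, u), (b, v u), (c, w u), - (a, u), - (b, v u), - (c, w u)}" for u
  have v_mem: "v u \<in> {- q..q}" and w_mem: "w u \<in> {- q..q}" if "u \<in> {- q..q}" for u
    using v w that unfolding bij_betw_def by blast+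
  have v_surj: "\<exists>u\<in>{- q..q}. y = v u" and w_surj: "\<exists>u\<in>{- q..q}. y = w u" if "y \<in> {- q..q}" for y
    using v w that unfolding bij_betw_def by blast+
  have "{a, b, c, - a, - b, - c} \<times> {- q..q} = (\<Union>u\<in>{- q..q}. D u)"
  proof (intro set_eqI iffI)
    fix z
    assume "z \<in> {a, b, c, - a, - b, - c} \<times> {- q..q}"
    then obtain x y where z: "z = (x, y)" "y \<in> {- q..q}" and x: "x \<in> {a, b, c, - a, - b, - c}"
      by blast
    \<comment> \<open>The rows of \<open>- a\<close>, \<open>- b\<close>, \<open>- c\<close> hold
      the negated points, so their indices are preimages of \<open>- y\<close>.\<close>
    have "- y \<in> {- q..q}"
      using z(2) by simp
    obtain v1 v2 w1 w2 where "v1 \<in> {- q..q}" "y = v v1" "v2 \<in> {- q..q}" "- y = v v2"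
        "w1 \<in> {- q..q}" "y = w w1" "w2 \<in> {- q..q}" "- y = w w2"
      using v_surj[OF z(2)] v_surj[OF \<open>- y \<in> {- q..q}\<close>] w_surj[OF z(2)] w_surj[OF \<open>- y \<in> {- q..q}\<close>]
      by blast
    moreover from this have "y = - v v2" "y = - w w2"
      by linarith+
    ultimately have "z \<in> D y \<or> z \<in> D v1 \<or> z \<in> D w1 \<or> z \<in> D (- y) \<or> z \<in> D v2 \<or> z \<in> D w2"
      using x unfolding D_def z(1) by (elim insertE emptyE) simp_all
    then show "z \<in> (\<Union>u\<in>{- q..q}. D u)"
      using z(2) \<open>- y \<in> {- q..q}\<close> \<open>v1 \<in> _\<close> \<open>v2 \<in> _\<close> \<open>w1 \<in> _\<close> \<open>w2 \<in> _\<close> by blast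
  next
    fix z
    assume "z \<in> (\<Union>u\<in>{- q..q}. D u)"
    then obtain u where u: "u \<in> {- q..q}" "z \<in> D u"
      by blast
    then show "z \<in> {a, b, c, - a, - b, - c} \<times> {- q..q}"
      using v_mem[OF u(1)] w_mem[OF u(1)] unfolding D_def by (elim insertE emptyE) simp_all
  qed
  moreover have "decomposable {3} (\<Union>u\<in>{- q..q}. D u)"
  proof (rule decomposable_UN)
    fix u
    show "decomposable {3} (D u)"
      unfolding D_def
      by (rule decomposable_triple) (use abc in \<open>auto simp: w_def zero_prod_def\<close>)
  next
    fix u u'
    assume u: "u \<in> {- q..q}" "u' \<in> {- q..q}" and "D u \<inter> D u' \<noteq> {}"
    then obtain z where "z \<in> D u" "z \<in> D u'"
      by blast
    then have "u = u' \<or> v u = v u' \<or> w u = w u'"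
      unfolding D_def by (elim insertE emptyE) (use abc(2) in simp_all)
    then show "u = u'"
      using u v w unfolding bij_betw_def inj_on_def by blast
  qed simp
  ultimately show ?thesis
    by simp
qed

text \<open>Blocks of size 3 come with a zero-sum triple. The interval includes 0, so whole strips
  of a grid can be removed.\<close>

lemma decomposable_times_interval:
  assumes "decomposable {3} R"
  shows "decomposable {3} (R \<times> {- q..q::int})"
  using assms
proof (induction R)
  case empty
  then show ?case by (simp add: decomposable.empty)
next
  case (block D B)
  have "card B = 3"
    using block.hyps by simp
  then have "decomposable {3} (diffs B \<times> {- q..q})"
    using card_3_diffs[OF _ block.hyps(4)] decomposable_triple_times_interval by metis
  then have "decomposable {3} (diffs B \<times> {- q..q} \<union> D \<times> {- q..q})"
    using block by (intro decomposable_Un) auto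
  then show ?case by (simp add: Sigma_Un_distrib1)
qed

lemma decomposable_scale:
  fixes r s :: int
  assumes "decomposable K D" "r \<noteq> 0" "s \<noteq> 0"
  shows "decomposable K ((\<lambda>(x, y). (r * x, s * y)) ` D)"
  using assms(1)
  by (rule decomposable_image[rotated 2]) (use assms(2,3) in \<open>auto simp: inj_def algebra_simps\<close>)

lemma decomposable_concat_diff_list:
  assumes "distinct (concat (map diff_list bss))" "\<forall>bs\<in>set bss. distinct bs \<and> length bs \<in> K"
  shows "decomposable K (set (concat (map diff_list bss)))"
  using assms
proof (induction bss)
  case Nil
  then show ?case by (simp add: decomposable.empty)
next
  case (Cons bs bss)
  then have "decomposable K (diffs (set bs))"
    by (intro decomposable_diffs distinct_diffs_set) (auto simp: distinct_card)
  then have "decomposable K (diffs (set bs) \<union> set (concat (map diff_list bss)))"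
    using Cons by (intro decomposable_Un) (auto simp: diffs_set)
  then show ?case
    by (simp add: diffs_set)
qed

text \<open>One distinctness test covers differences within a block and between blocks; all three
  conditions can be evaluated.\<close>

lemma decomposable_blocks:
  assumes "distinct (concat (map diff_list bss))" "\<forall>bs\<in>set bss. distinct bs \<and> length bs \<in> K"
    and "set (concat (map diff_list bss)) = D"
  shows "decomposable K D"
  using decomposable_concat_diff_list[OF assms(1,2)] assms(3) by simp

section \<open>Partitions of integer intervals\<close>

definition symm :: "int set \<Rightarrow> int set" where
  "symm U = U \<union> uminus ` U"

text \<open>A pair \<open>(a, b)\<close> stands for the triple \<open>a + b = c\<close>. As in the theory of Skolem and Langford
  sequences, \<open>a\<close> is small and \<open>b\<close>, \<open>a + b\<close> are the two positions at distance
  \<open>a\<close>; a family consists of nested pairs of positions.\<close>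

definition family :: "int \<Rightarrow> int \<Rightarrow> int \<Rightarrow> (int \<times> int) list" where
  "family d x L = map (\<lambda>i. (d + 2 * i, x - i)) [0..L - 1]"

text \<open>Predicates rather than sets: unfolded on an explicit list, membership becomes linear
  arithmetic, with parity only on the small side.\<close>

fun small :: "(int \<times> int) list \<Rightarrow> int \<Rightarrow> bool" where
  "small [] z = False"
| "small ((a, b) # xs) z = (z = a \<or> small xs z)"

fun large :: "(int \<times> int) list \<Rightarrow> int \<Rightarrow> bool" where
  "large [] z = False"
| "large ((a, b) # xs) z = (z = b \<or> z = a + b \<or> large xs z)"

lemma small_append: "small (xs @ ys) z \<longleftrightarrow> small xs z \<or> small ys z"
  by (induction xs z rule: small.induct) auto

lemma large_append: "large (xs @ ys) z \<longleftrightarrow> large xs z \<or> large ys z"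
  by (induction xs z rule: large.induct) auto

lemma small_iff: "small xs z \<longleftrightarrow> (\<exists>(a, b) \<in> set xs. z = a)"
  by (induction xs z rule: small.induct) auto

lemma large_iff: "large xs z \<longleftrightarrow> (\<exists>(a, b) \<in> set xs. z \<in> {b, a + b})"
  by (induction xs z rule: large.induct) auto

lemma small_family: "small (family d x L) z \<longleftrightarrow> d \<le> z \<and> z < d + 2 * L \<and> even (z - d)"
  (is "_ \<longleftrightarrow> ?A")
proof -
  have "small (family d x L) z \<longleftrightarrow> (\<exists>i. 0 \<le> i \<and> i < L \<and> z = d + 2 * i)"
    by (fastforce simp: small_iff family_def)
  also have "\<dots> \<longleftrightarrow> ?A"
    by presburger
  finally show ?thesis .
qed

text \<open>As \<open>(d + 2 * i) + (x - i) = d + x + i\<close>, the positions run down from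
  \<open>x\<close> and up from \<open>d + x\<close> without gaps.\<close>

lemma large_family:
  "large (family d x L) z \<longleftrightarrow> (x - L < z \<and> z \<le> x) \<or> (d + x \<le> z \<and> z < d + x + L)"
  (is "_ \<longleftrightarrow> ?B")
proof -
  have "large (family d x L) z \<longleftrightarrow> (\<exists>i. 0 \<le> i \<and> i < L \<and> (z = x - i \<or> z = d + x + i))"
    by (fastforce simp: large_iff family_def)
  also have "\<dots> \<longleftrightarrow> ?B"
    by presburger
  finally show ?thesis .
qed

lemma length_family: "length (family d x L) = nat L"
  by (simp add: family_def)

lemma card_le_length:
  assumes "finite U" "\<forall>z\<in>U. small ts z \<or> large ts z"
  shows "card U \<le> 3 * length ts"
  using assms
proof (induction ts arbitrary: U)
  case Nil
  then show ?case by auto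
next
  case (Cons t ts)
  obtain a b where t: "t = (a, b)" by force
  have "card U \<le> card (U - {a, b, a + b}) + card {a, b, a + b}"
    using Cons.prems(1) by (metis add.commute card_Un_le card_mono finite_Diff finite.emptyI finite.insertI finite_UnI
        order_trans Un_Diff_cancel Un_upper2)
  also have "card (U - {a, b, a + b}) \<le> 3 * length ts"
    using Cons.prems t by (intro Cons.IH) auto
  also have "card {a, b, a + b} \<le> 3"
    by (simp add: card_insert_if)
  finally show ?case by simp
qed

lemma symm_iff: "\<forall>a\<in>A. 0 < a \<Longrightarrow> z \<in> symm A \<longleftrightarrow> \<bar>z\<bar> \<in> A"
  by (auto simp: symm_def abs_if image_iff) (metis minus_minus)

lemma symm_disjoint: "\<forall>z\<in>A. 0 < z \<Longrightarrow> \<forall>z\<in>B. 0 < z \<Longrightarrow> A \<inter> B = {} \<Longrightarrow> symm A \<inter> symm B = {}"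
  by (auto simp: symm_iff)

text \<open>Covering suffices: the cardinalities then force the triples to be disjoint and to stay inside
  \<open>U\<close>, so neither has to be checked for the explicit lists below.\<close>

lemma decomposable_symm:
  assumes "finite U" "\<forall>z\<in>U. 0 < z" "3 * length ts \<le> card U" "\<forall>z\<in>U. small ts z \<or> large ts z"
  shows "decomposable {3} (symm U)"
  using assms
proof (induction ts arbitrary: U)
  case Nil
  then have "U = {}" by auto
  then show ?case by (simp add: symm_def decomposable.empty)
next
  case (Cons t ts)
  obtain a b where t: "t = (a, b)" by force
  define S where "S = {a, b, a + b}"
  have cov: "\<forall>z\<in>U - S. small ts z \<or> large ts z"
    using Cons.prems(4) by (auto simp: t S_def)
  \<comment> \<open>The remaining triples cover at most three elements each, so \<open>S\<close>
    must contribute three elements of \<open>U\<close>; having at most three, it is a three-element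
    subset of \<open>U\<close>.\<close>
  then have le: "card (U - S) \<le> 3 * length ts"
    using Cons.prems(1) by (intro card_le_length) auto
  moreover have "card U = card (U \<inter> S) + card (U - S)"
    using Cons.prems(1) by (metis card_Int_Diff)
  ultimately have "card (U \<inter> S) \<ge> 3" and ge: "card (U - S) + card (U \<inter> S) \<ge> 3 + 3 * length ts"
    using Cons.prems(3) by simp_all
  moreover have S3: "card S \<le> 3"
    by (simp add: S_def card_insert_if)
  moreover have "finite S"
    by (simp add: S_def)
  moreover from this have "card (U \<inter> S) \<le> card S"
    by (rule card_mono) (rule Int_lower2)
  ultimately have "card (U \<inter> S) = card S" "card S = 3" "3 * length ts \<le> card (U - S)"
    by linarith+
  then have "S \<subseteq> U"
    using card_subset_eq[OF \<open>finite S\<close> Int_lower2] by blast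
  have "decomposable {3} (symm (U - S))"
    using Cons.prems cov \<open>3 * length ts \<le> card (U - S)\<close> by (intro Cons.IH) auto
  moreover from \<open>S \<subseteq> U\<close> Cons.prems(2) have pos: "0 < a" "0 < b"
    by (auto simp: S_def)
  have "decomposable {3} {a, b, - (a + b), - a, - b, - (- (a + b))}"
    by (rule decomposable_triple) (use \<open>card S = 3\<close> pos in \<open>auto simp: S_def card_insert_if split: if_splits\<close>)
  moreover have "{a, b, - (a + b), - a, - b, - (- (a + b))} = symm S"
    by (auto simp: symm_def S_def)
  ultimately have "decomposable {3} (symm (U - S) \<union> symm S)"
    using Cons.prems(2) \<open>S \<subseteq> U\<close>
    by (intro decomposable_Un symm_disjoint) auto
  moreover have "symm (U - S) \<union> symm S = symm U"
    using \<open>S \<subseteq> U\<close> by (auto simp: symm_def)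
  ultimately show ?case
    by simp
qed

section \<open>Infinite families of triple partitions\<close>

lemma skolem_0:
  fixes s :: int
  assumes "2 \<le> s"
  shows "decomposable {3} (symm {1..12*s})"
proof (rule decomposable_symm)
  \<comment> \<open>The evens up to \<open>4 * s\<close> occupy \<open>8 * s..12 * s\<close> around
    the gap \<open>10 * s\<close>; the other families take the odds
    \<open>2 * s + 3..4 * s - 3\<close> and \<open>3..2 * s - 3\<close>. The single pairs use the
    odds left over and fill the remaining positions.\<close>
  let ?ts = "family 2 (10*s - 1) (2*s) @ family (2*s + 3) (5*s - 2) (s - 2) @ family 3 (6*s - 1) (s - 2) @
      [(2*s + 1, 5*s - 1), (1, 5*s), (2*s - 1, 6*s), (4*s - 1, 6*s + 1)]"
  have "3 * length ?ts = nat (12*s)"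
    using assms by (simp add: length_family nat_eq_iff)
  also have "\<dots> = card {1..12*s}"
    using assms by simp
  finally show "3 * length ?ts \<le> card {1..12*s}"
    by simp
  \<comment> \<open>The \<open>4 * s\<close> triples have small members \<open>1..4 * s\<close>; all
    larger numbers are positions.\<close>
  have "small ?ts z" if "z \<in> {1..12*s}" "z \<le> 4*s" for z
    using that assms unfolding small.simps small_append small_family Diff_iff atLeastAtMost_iff
      insert_iff empty_iff by presburger
  moreover have "large ?ts z" if "z \<in> {1..12*s}" "\<not> z \<le> 4*s" for z
    using that assms unfolding large.simps large_append large_family Diff_iff atLeastAtMost_iff
    by (smt (verit))
  ultimately show "\<forall>z\<in>{1..12*s}. small ?ts z \<or> large ?ts z"
    by blast
qed auto

lemma skolem_1:
  fixes s :: int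
  assumes "2 \<le> s"
  shows "decomposable {3} (symm {1..12*s + 3})"
proof (rule decomposable_symm)
  \<comment> \<open>The same pattern: the evens lie around the gap \<open>10 * s + 3\<close>, and
    the single pairs use the odds \<open>1\<close>, \<open>2 * s - 1\<close>,
    \<open>4 * s + 1\<close>.\<close>
  let ?ts = "family 2 (10*s + 2) (2*s) @ family (2*s + 1) (5*s + 1) s @ family 3 (6*s + 1) (s - 2) @
      [(1, 5*s + 2), (4*s + 1, 6*s + 2), (2*s - 1, 6*s + 3)]"
  have "3 * length ?ts = nat (12*s + 3)"
    using assms by (simp add: length_family nat_eq_iff)
  also have "\<dots> = card {1..12*s + 3}"
    using assms by simp
  finally show "3 * length ?ts \<le> card {1..12*s + 3}"
    by simp
  have "small ?ts z" if "z \<in> {1..12*s + 3}" "z \<le> 4*s + 1" for z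
    using that assms unfolding small.simps small_append small_family Diff_iff atLeastAtMost_iff
      insert_iff empty_iff by presburger
  moreover have "large ?ts z" if "z \<in> {1..12*s + 3}" "\<not> z \<le> 4*s + 1" for z
    using that assms unfolding large.simps large_append large_family Diff_iff atLeastAtMost_iff
    by (smt (verit))
  ultimately show "\<forall>z\<in>{1..12*s + 3}. small ?ts z \<or> large ?ts z"
    by blast
qed auto

text \<open>The sporadic pairs of the following four lists were found by an exact cover search at the ends
  of the families.\<close>

lemma langford_0:
  fixes s :: int
  assumes "4 \<le> s"
  shows "decomposable {3} (symm {3..12*s + 2})"
proof (rule decomposable_symm)
  let ?ts = "family 8 (10*s + 1) (2*s - 6) @ family (2*s + 7) (5*s) (s - 4) @ family 5 (6*s + 4) (s - 4) @
      [(3, 5*s + 3), (2*s + 3, 5*s + 2), (4, 5*s + 4), (2*s + 1, 5*s + 5), (6, 5*s + 1),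
       (2*s + 5, 8*s + 3), (4*s + 1, 4*s + 3), (4*s + 2, 4*s + 4), (2*s - 3, 8*s + 5),
       (2*s - 1, 8*s + 7), (4*s - 2, 6*s + 6), (4*s, 6*s + 5), (4*s - 4, 6*s + 7),
       (4*s - 1, 6*s + 8)]"
  have "3 * length ?ts = nat (12*s)"
    using assms by (simp add: length_family nat_eq_iff)
  also have "\<dots> = card {3..12*s + 2}"
    using assms by simp
  finally show "3 * length ?ts \<le> card {3..12*s + 2}"
    by simp
  have "small ?ts z" if "z \<in> {3..12*s + 2}" "z \<le> 4*s + 2" for z
    using that assms unfolding small.simps small_append small_family Diff_iff atLeastAtMost_iff
      insert_iff empty_iff by presburger
  moreover have "large ?ts z" if "z \<in> {3..12*s + 2}" "\<not> z \<le> 4*s + 2" for z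
    using that assms unfolding large.simps large_append large_family Diff_iff atLeastAtMost_iff
    by (smt (verit))
  ultimately show "\<forall>z\<in>{3..12*s + 2}. small ?ts z \<or> large ?ts z"
    by blast
qed auto

lemma langford_1:
  fixes s :: int
  assumes "4 \<le> s"
  shows "decomposable {3} (symm {3..12*s + 5})"
proof (rule decomposable_symm)
  let ?ts = "family 8 (10*s + 2) (2*s - 5) @ family (2*s + 7) (5*s) (s - 4) @ family 5 (6*s + 4) (s - 4) @
      [(3, 5*s + 3), (2*s + 3, 5*s + 2), (4, 5*s + 4), (2*s + 1, 5*s + 5), (6, 5*s + 1),
       (2*s + 5, 8*s + 3), (4*s + 3, 6*s + 6), (4*s + 2, 4*s + 4), (2*s - 1, 8*s + 4),
       (4*s + 1, 6*s + 5), (2*s - 3, 8*s + 7), (4*s - 1, 6*s + 8), (4*s - 2, 6*s + 7),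
       (4*s, 8*s + 5)]"
  have "3 * length ?ts = nat (12*s + 3)"
    using assms by (simp add: length_family nat_eq_iff)
  also have "\<dots> = card {3..12*s + 5}"
    using assms by simp
  finally show "3 * length ?ts \<le> card {3..12*s + 5}"
    by simp
  have "small ?ts z" if "z \<in> {3..12*s + 5}" "z \<le> 4*s + 3" for z
    using that assms unfolding small.simps small_append small_family Diff_iff atLeastAtMost_iff
      insert_iff empty_iff by presburger
  moreover have "large ?ts z" if "z \<in> {3..12*s + 5}" "\<not> z \<le> 4*s + 3" for z
    using that assms unfolding large.simps large_append large_family Diff_iff atLeastAtMost_iff
    by (smt (verit))
  ultimately show "\<forall>z\<in>{3..12*s + 5}. small ?ts z \<or> large ?ts z"
    by blast
qed auto

lemma hole_2:
  fixes s :: int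
  assumes "2 \<le> s"
  shows "decomposable {3} (symm ({1..12*s + 8} - {2, 4}))"
proof (rule decomposable_symm)
  let ?ts = "family 5 (10*s + 4) (2*s) @ family (2*s + 4) (5*s + 2) (s - 2) @ family 6 (6*s + 2) (s - 2) @
      [(1, 5*s + 3), (2*s + 2, 8*s + 4), (3, 6*s + 4), (4*s + 2, 6*s + 6), (4*s + 4, 6*s + 3),
       (4*s, 6*s + 5)]"
  have "3 * length ?ts = nat (12*s + 6)"
    using assms by (simp add: length_family nat_eq_iff)
  also have "\<dots> = card ({1..12*s + 8} - {2, 4})"
    using assms by (simp add: card_Diff_subset)
  finally show "3 * length ?ts \<le> card ({1..12*s + 8} - {2, 4})"
    by simp
  \<comment> \<open>Skipping 2 and 4, the \<open>4 * s + 2\<close> small members reach up to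
    \<open>4 * s + 4\<close>.\<close>
  have "small ?ts z" if "z \<in> {1..12*s + 8} - {2, 4}" "z \<le> 4*s + 4" for z
    using that assms unfolding small.simps small_append small_family Diff_iff atLeastAtMost_iff
      insert_iff empty_iff by presburger
  moreover have "large ?ts z" if "z \<in> {1..12*s + 8} - {2, 4}" "\<not> z \<le> 4*s + 4" for z
    using that assms unfolding large.simps large_append large_family Diff_iff atLeastAtMost_iff
    by (smt (verit))
  ultimately show "\<forall>z\<in>{1..12*s + 8} - {2, 4}. small ?ts z \<or> large ?ts z"
    by blast
qed auto

lemma hole_3:
  fixes s :: int
  assumes "2 \<le> s"
  shows "decomposable {3} (symm ({1..12*s + 11} - {2, 4}))"
proof (rule decomposable_symm)
  let ?ts = "family 5 (10*s + 6) (2*s) @ family (2*s + 4) (5*s + 4) (s - 2) @ family 6 (6*s + 2) (s - 2) @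
      [(4*s, 4*s + 6), (1, 7*s + 6), (2*s + 2, 10*s + 9), (3, 6*s + 4), (4*s + 4, 6*s + 3),
       (4*s + 5, 6*s + 5), (4*s + 2, 6*s + 6)]"
  have "3 * length ?ts = nat (12*s + 9)"
    using assms by (simp add: length_family nat_eq_iff)
  also have "\<dots> = card ({1..12*s + 11} - {2, 4})"
    using assms by (simp add: card_Diff_subset)
  finally show "3 * length ?ts \<le> card ({1..12*s + 11} - {2, 4})"
    by simp
  have "small ?ts z" if "z \<in> {1..12*s + 11} - {2, 4}" "z \<le> 4*s + 5" for z
    using that assms unfolding small.simps small_append small_family Diff_iff atLeastAtMost_iff
      insert_iff empty_iff by presburger
  moreover have "large ?ts z" if "z \<in> {1..12*s + 11} - {2, 4}" "\<not> z \<le> 4*s + 5" for z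
    using that assms unfolding large.simps large_append large_family Diff_iff atLeastAtMost_iff
    by (smt (verit))
  ultimately show "\<forall>z\<in>{1..12*s + 11} - {2, 4}. small ?ts z \<or> large ?ts z"
    by blast
qed auto

section \<open>Small lengths, checked by evaluation\<close>

lemma decomposable_symm_list:
  assumes "set us = U" and "list_all (\<lambda>z. 0 < z \<and> (small ts z \<or> large ts z)) us" "distinct us"
    and "3 * length ts \<le> length us"
  shows "decomposable {3} (symm U)"
  using assms by (intro decomposable_symm[where ts = ts]) (auto simp: list_all_iff distinct_card)

lemma skolem_small_0: "decomposable {3} (symm {1..3})"
  by (rule decomposable_symm_list[where us = "[1..3]"
        and ts = "[(1, 2)]"])
    (simp only: set_upto, code_simp+)

lemma skolem_small_1: "decomposable {3} (symm {1..12})"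
  by (rule decomposable_symm_list[where us = "[1..12]"
        and ts = "[(1, 11), (2, 6), (4, 5), (3, 7)]"])
    (simp only: set_upto, code_simp+)

lemma skolem_small_2: "decomposable {3} (symm {1..15})"
  by (rule decomposable_symm_list[where us = "[1..15]"
        and ts = "[(1, 13), (2, 8), (5, 7), (3, 6), (4, 11)]"])
    (simp only: set_upto, code_simp+)

lemma langford_small_0: "decomposable {3} (symm {3..17})"
  by (rule decomposable_symm_list[where us = "[3..17]"
        and ts = "[(3, 11), (5, 10), (6, 7), (8, 9), (4, 12)]"])
    (simp only: set_upto, code_simp+)

lemma langford_small_1: "decomposable {3} (symm {3..26})"
  by (rule decomposable_symm_list[where us = "[3..26]"
        and ts = "[(3, 21), (4, 16), (5, 17), (6, 9), (10, 13), (8, 11), (7, 18), (12, 14)]"])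
    (simp only: set_upto, code_simp+)

lemma langford_small_2: "decomposable {3} (symm {3..29})"
  by (rule decomposable_symm_list[where us = "[3..29]"
        and ts = "[(3, 23), (5, 22), (4, 14), (7, 17), (9, 11), (8, 21), (10, 15), (6, 13), (12, 16)]"])
    (simp only: set_upto, code_simp+)

lemma langford_small_3: "decomposable {3} (symm {3..38})"
  by (rule decomposable_symm_list[where us = "[3..38]"
        and ts = "[(3, 33), (4, 28), (5, 29), (6, 16), (8, 15), (9, 26), (11, 19), (12, 25),
            (13, 18), (7, 20), (10, 14), (17, 21)]"])
    (simp only: set_upto, code_simp+)

lemma langford_small_4: "decomposable {3} (symm {3..41})"
  by (rule decomposable_symm_list[where us = "[3..41]"
        and ts = "[(3, 35), (5, 34), (4, 24), (6, 30), (8, 29), (9, 17), (7, 16), (10, 15),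
            (11, 20), (12, 21), (14, 18), (13, 27), (19, 22)]"])
    (simp only: set_upto, code_simp+)

lemma hole_small_0: "decomposable {3} (symm ({1..8} - {2, 4}))"
  by (rule decomposable_symm_list[where us = "1 # 3 # [5..8]"
        and ts = "[(3, 5), (1, 6)]"])
    ((simp add: set_eq_iff, presburger), code_simp+)

lemma hole_small_1: "decomposable {3} (symm ({1..20} - {2, 4}))"
  by (rule decomposable_symm_list[where us = "1 # 3 # [5..20]"
        and ts = "[(1, 15), (5, 13), (7, 10), (8, 11), (3, 9), (6, 14)]"])
    ((simp add: set_eq_iff, presburger), code_simp+)

lemma hole_small_2: "decomposable {3} (symm ({1..11} - {2, 4}))"
  by (rule decomposable_symm_list[where us = "1 # 3 # [5..11]"
        and ts = "[(5, 6), (3, 7), (1, 8)]"])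
    ((simp add: set_eq_iff, presburger), code_simp+)

lemma hole_small_3: "decomposable {3} (symm ({1..23} - {2, 4}))"
  by (rule decomposable_symm_list[where us = "1 # 3 # [5..23]"
        and ts = "[(1, 17), (5, 15), (7, 14), (8, 11), (10, 13), (3, 9), (6, 16)]"])
    ((simp add: set_eq_iff, presburger), code_simp+)

section \<open>Partitions for all admissible lengths\<close>

lemma symm_atLeastAtMost: "symm {1..p} = {- p..p} - {0}"
  by (auto simp: symm_iff abs_if split: if_splits)

lemma symm_Un: "symm (A \<union> B) = symm A \<union> symm B"
  by (auto simp: symm_def)

text \<open>Triples \<open>a + b = c\<close> have even total, which forces the residues of
  \<open>t\<close> here and in the next two lemmas. Lengths 1 and 4 fail: \<open>{3, 4, 5}\<close>
  is no triple, and the four sums in \<open>{3..14}\<close> would have to total 51, while 11 + 12 +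
  13 + 14 = 50.\<close>

lemma decomposable_langford:
  fixes t :: int
  assumes "t mod 4 \<in> {0, 1}" "t = 0 \<or> 5 \<le> t"
  shows "decomposable {3} (symm {3..3 * t + 2})"
proof -
  define s where "s = t div 4"
  \<comment> \<open>The general lists contain families of length \<open>s - 4\<close>, so the
    admissible \<open>t\<close> below 16 are listed separately.\<close>
  have "t = 0 \<or> t = 5 \<or> t = 8 \<or> t = 9 \<or> t = 12 \<or> t = 13 \<or> (t = 4 * s \<and> 4 \<le> s) \<or> (t = 4 * s + 1 \<and> 4 \<le> s)"
    using assms unfolding s_def insert_iff empty_iff by presburger
  then consider "t = 0" | "t = 5" | "t = 8" | "t = 9" | "t = 12" | "t = 13" | "t = 4 * s" "4 \<le> s" |
    "t = 4 * s + 1" "4 \<le> s"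
    by blast
  then show ?thesis
  proof cases
    case 1
    then show ?thesis by (simp add: symm_def decomposable.empty)
  qed (use langford_small_0 langford_small_1 langford_small_2 langford_small_3 langford_small_4
      langford_0[of s] langford_1[of s] in \<open>simp_all add: algebra_simps\<close>)
qed

lemma decomposable_skolem:
  fixes t :: int
  assumes "t mod 4 \<in> {0, 1}" "0 \<le> t"
  shows "decomposable {3} (symm {1..3 * t})"
proof -
  define s where "s = t div 4"
  have "t = 0 \<or> t = 1 \<or> t = 4 \<or> t = 5 \<or> (t = 4 * s \<and> 2 \<le> s) \<or> (t = 4 * s + 1 \<and> 2 \<le> s)"
    using assms unfolding s_def insert_iff empty_iff by presburger
  then consider "t = 0" | "t = 1" | "t = 4" | "t = 5" | "t = 4 * s" "2 \<le> s" | "t = 4 * s + 1" "2 \<le> s"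
    by blast
  then show ?thesis
  proof cases
    case 1
    then show ?thesis by (simp add: symm_def decomposable.empty)
  qed (use skolem_small_0 skolem_small_1 skolem_small_2 skolem_0[of s] skolem_1[of s]
      in \<open>simp_all add: algebra_simps\<close>)
qed

lemma decomposable_hole:
  fixes t :: int
  assumes "t mod 4 \<in> {2, 3}" "2 \<le> t"
  shows "decomposable {3} (symm ({1..3 * t + 2} - {2, 4}))"
proof -
  define s where "s = t div 4"
  have "t = 2 \<or> t = 3 \<or> t = 6 \<or> t = 7 \<or> (t = 4 * s + 2 \<and> 2 \<le> s) \<or> (t = 4 * s + 3 \<and> 2 \<le> s)"
    using assms unfolding s_def insert_iff empty_iff by presburger
  then consider "t = 2" | "t = 3" | "t = 6" | "t = 7" | "t = 4 * s + 2" "2 \<le> s" | "t = 4 * s + 3" "2 \<le> s"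
    by blast
  then show ?thesis
    by cases (use hole_small_0 hole_small_1 hole_small_2 hole_small_3 hole_2[of s] hole_3[of s]
      in \<open>simp_all add: algebra_simps\<close>)
qed

text \<open>For \<open>t = 3\<close> and \<open>t = 6\<close> the general construction would leave
  \<open>t - 2\<close> triples, an impossible length 1 or 4; direct blocks replace it.\<close>

lemma decomposable_interval_9: "decomposable {3, 4} ({- 9..9} - {0} :: int set)"
  by (rule decomposable_blocks[of "[[0, 3, 5, 9], [0, 1, 8]]"]) code_simp+

lemma decomposable_interval_18: "decomposable {3, 4} ({- 18..18} - {0} :: int set)"
  by (rule decomposable_blocks[of "[[0, 1, 6, 18], [0, 3, 11], [0, 4, 14], [0, 2, 15], [0, 7, 16]]"])
    code_simp+

text \<open>For \<open>t mod 4\<close> equal to 2 or 3 the sum of \<open>1..3 * t\<close> is odd, so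
  triples alone fail. The six positive differences of the block of size 4 add up to
  \<open>4 * b + 9\<close>, which restores the parity.\<close>

lemma decomposable_interval:
  fixes t :: int
  assumes "0 \<le> t"
  shows "decomposable {3, 4} ({- (3 * t)..3 * t} - {0})"
proof -
  have "t mod 4 \<in> {0, 1} \<or> t = 3 \<or> t = 6 \<or> ((t - 2) mod 4 \<in> {0, 1} \<and> (t - 2 = 0 \<or> 5 \<le> t - 2))"
    using assms unfolding insert_iff empty_iff by presburger
  then consider "t mod 4 \<in> {0, 1}" | "t = 3" | "t = 6" | "(t - 2) mod 4 \<in> {0, 1}" "t - 2 = 0 \<or> 5 \<le> t - 2"
    by blast
  then show ?thesis
  proof cases
    case 1
    then show ?thesis
      using decomposable_mono[OF decomposable_skolem] assms by (simp add: symm_atLeastAtMost)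
  next
    case 4
    \<comment> \<open>Chosen so that \<open>b + 3 = 3 * t\<close> and
      \<open>b - 1 = 3 * (t - 2) + 2\<close>; for \<open>t = 2\<close> the interval
      \<open>{3..b - 1}\<close> is empty.\<close>
    define b where "b = 3 * t - 3"
    have b: "3 \<le> b"
      using 4(2) by (auto simp: b_def)
    let ?B = "{0, 1, b + 1, b + 3}"
    have "diff_list [0, 1, b + 1, b + 3] = [- 1, - b - 1, - b - 3, 1, - b, - b - 2, b + 1, b, - 2, b + 3, b + 2, 2]"
      using b by (simp add: diff_list_def)
    then have "distinct_diffs ?B" "diffs ?B = symm {1, 2, b, b + 1, b + 2, b + 3}"
      using b distinct_diffs_set[of "[0, 1, b + 1, b + 3]"] diffs_set[of "[0, 1, b + 1, b + 3]"]
      by (auto simp: symm_def)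
    moreover have "card ?B = 4"
      using b by simp
    ultimately have "decomposable {3, 4} (symm {1, 2, b, b + 1, b + 2, b + 3})"
      using decomposable_diffs[of ?B "{3, 4}"] by simp
    moreover have "decomposable {3, 4} (symm {3..b - 1})"
      using decomposable_mono[OF decomposable_langford[OF 4]] by (simp add: b_def)
    moreover have "symm {1, 2, b, b + 1, b + 2, b + 3} \<inter> symm {3..b - 1} = {}"
      using b by (intro symm_disjoint) auto
    ultimately have "decomposable {3, 4} (symm ({1, 2, b, b + 1, b + 2, b + 3} \<union> {3..b - 1}))"
      unfolding symm_Un by (rule decomposable_Un)
    moreover have "{1, 2, b, b + 1, b + 2, b + 3} \<union> {3..b - 1} = {1..3 * t}"
      using b unfolding b_def by auto
    ultimately show ?thesis
      by (simp add: symm_atLeastAtMost)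
  qed (use decomposable_interval_9 decomposable_interval_18 in simp_all)
qed

section \<open>Grids\<close>

text \<open>Each core uses one block of size 4 and otherwise triples: 24 = 12 + 2 * 6 here, then 54
  = 12 + 7 * 6 and 120 = 12 + 18 * 6.\<close>

definition core_5_5_blocks :: "(int \<times> int) list list" where
  "core_5_5_blocks =
  [[(0, 0), (-1, 0), (-2, -2), (0, -1)], [(0, 0), (0, 2), (2, 0)], [(0, 0), (1, -2), (2, -1)]]"

lemma core_5_5: "decomposable {3, 4} ({- 2..2} \<times> {- 2..2} - {(0, 0)} :: (int \<times> int) set)"
  by (rule decomposable_blocks[of core_5_5_blocks]) code_simp+

definition core_5_11_blocks :: "(int \<times> int) list list" where
  "core_5_11_blocks =
  [[(0, 0), (1, -2), (1, 1), (-1, -4)], [(0, 0), (1, -1), (2, 4)], [(0, 0), (0, 5), (2, 3)],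
   [(0, 0), (1, -3), (2, 0)], [(0, 0), (1, -5), (2, -3)], [(0, 0), (0, 1), (2, -4)],
   [(0, 0), (0, 2), (2, 1)], [(0, 0), (0, 4), (1, 0)]]"

lemma core_5_11: "decomposable {3, 4} ({- 2..2} \<times> {- 5..5} - {(0, 0)} :: (int \<times> int) set)"
  by (rule decomposable_blocks[of core_5_11_blocks]) code_simp+

definition core_11_11_blocks :: "(int \<times> int) list list" where
  "core_11_11_blocks =
  [[(0, 0), (-2, 4), (1, 2), (2, -1)], [(0, 0), (1, -4), (5, -5)], [(0, 0), (2, -5), (5, -4)],
   [(0, 0), (1, 4), (5, 0)], [(0, 0), (0, 5), (3, 0)], [(0, 0), (2, 0), (5, -3)],
   [(0, 0), (0, 3), (4, 0)], [(0, 0), (1, 0), (5, -2)], [(0, 0), (1, -5), (5, -1)],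
   [(0, 0), (1, 5), (4, 1)], [(0, 0), (0, 4), (2, 2)], [(0, 0), (2, -3), (5, 2)],
   [(0, 0), (1, -2), (5, 1)], [(0, 0), (2, 4), (5, 3)], [(0, 0), (0, 2), (2, 5)],
   [(0, 0), (1, -1), (5, 4)], [(0, 0), (1, 1), (3, 2)], [(0, 0), (0, 1), (3, 4)],
   [(0, 0), (1, 3), (5, 5)]]"

lemma core_11_11: "decomposable {3, 4} ({- 5..5} \<times> {- 5..5} - {(0, 0)} :: (int \<times> int) set)"
  by (rule decomposable_blocks[of core_11_11_blocks]) code_simp+

lemma hole_small_3_6: "decomposable {3} (symm ({1..14} - {3, 6}))"
  by (rule decomposable_symm_list[where us = "[1, 2, 4, 5] @ [7..14]" and
        ts = "[(2, 12), (4, 7), (5, 8), (1, 9)]"])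
    ((simp add: set_eq_iff, presburger), code_simp+)

text \<open>With signs and 0 the hole \<open>{x, 2 * x}\<close> is \<open>x * {- 2..2}\<close>, a
  stretched core. Removing \<open>3 * x\<close> must leave an even sum, so for such a hole
  \<open>x\<close> is odd if \<open>t mod 4\<close> is 0 or 1 and even otherwise.\<close>

lemma decomposable_hole_ex:
  fixes p :: int
  assumes "0 \<le> p" "p mod 3 = 2"
  obtains x k where "0 < x" "k \<in> {2, 5}" "x * k \<le> p"
    "decomposable {3} ({- p..p} - (*) x ` {- k..k})"
proof -
  define t where "t = p div 3"
  have p: "p = 3 * t + 2" "0 \<le> t"
    using assms unfolding t_def by presburger+
  have symm: "symm ({1..p} - {x, 2 * x}) = {- p..p} - (*) x ` {- 2..2}" if "0 < x" for x
  proof -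
    have "{- 2..2 :: int} = set [- 2, - 1, 0, 1, 2]"
      by code_simp
    then have "(*) x ` {- 2..2} = {- (2 * x), - x, 0, x, 2 * x}"
      by (simp add: mult.commute)
    moreover have "z \<in> symm ({1..p} - {x, 2 * x}) \<longleftrightarrow> z \<in> {- p..p} - {- (2 * x), - x, 0, x, 2 * x}" for z
      using that by (subst symm_iff) (auto simp: abs_if split: if_splits)
    ultimately show ?thesis
      by blast
  qed
  have "t = 1 \<or> t = 4 \<or> (t mod 4 \<in> {0, 1} \<and> (t = 0 \<or> 5 \<le> t)) \<or> (t mod 4 \<in> {2, 3} \<and> 2 \<le> t)"
    using p(2) unfolding insert_iff empty_iff by presburger
  then consider "t = 1" | "t = 4" | "t mod 4 \<in> {0, 1}" "t = 0 \<or> 5 \<le> t" | "t mod 4 \<in> {2, 3}" "2 \<le> t"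
    by blast
  then show ?thesis
  proof cases
    case 1
    \<comment> \<open>The whole interval is kept, with \<open>k = 5\<close> and nothing left to
      decompose.\<close>
    then have "{- p..p} - (*) 1 ` {- 5..5} = {}"
      by (simp add: p)
    then show ?thesis
      using that[of 1 5] 1 by (simp add: p decomposable.empty)
  next
    case 2
    \<comment> \<open>The hole \<open>{1, 2}\<close> would leave the impossible set
      \<open>{3..14}\<close>, so the next odd \<open>x\<close> is taken.\<close>
    then show ?thesis
      using that[of 3 2] symm[of 3] hole_small_3_6 by (simp add: p)
  next
    case 3
    have "{1..p} - {1, 2} = {3..p}"
      by auto
    then have "symm {3..p} = {- p..p} - (*) 1 ` {- 2..2}"
      using symm[of 1] by simp
    then show ?thesis
      using that[of 1 2] decomposable_langford[OF 3] p by simp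
  next
    case 4
    then show ?thesis
      using that[of 2 2] decomposable_hole[OF 4] symm[of 2] p by simp
  qed
qed

lemma decomposable_cores:
  assumes "k \<in> {2, 5}" "l \<in> {2, 5}"
  shows "decomposable {3, 4} ({- k..k} \<times> {- l..l} - {(0, 0)} :: (int \<times> int) set)"
proof -
  have "prod.swap ` ({- 2..2} \<times> {- 5..5} - {(0, 0)}) = ({- 5..5} \<times> {- 2..2} - {(0, 0)} :: (int \<times> int) set)"
    by (simp add: image_set_diff product_swap)
  then have "decomposable {3, 4} ({- 5..5} \<times> {- 2..2} - {(0, 0)} :: (int \<times> int) set)"
    using decomposable_swap[OF core_5_11] by simp
  then show ?thesis
    using assms core_5_5 core_5_11 core_11_11 by blast
qed

lemma decomposable_grid_mod_3_2:
  fixes p q :: int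
  assumes "0 \<le> p" "p mod 3 = 2" "0 \<le> q" "q mod 3 = 2"
  shows "decomposable {3, 4} ({- p..p} \<times> {- q..q} - {(0, 0)})"
proof -
  obtain x k where x: "0 < x" "k \<in> {2, 5}" "x * k \<le> p"
      and R: "decomposable {3} ({- p..p} - (*) x ` {- k..k})"
    using decomposable_hole_ex[OF assms(1,2)] .
  obtain y l where y: "0 < y" "l \<in> {2, 5}" "y * l \<le> q"
      and S: "decomposable {3} ({- q..q} - (*) y ` {- l..l})"
    using decomposable_hole_ex[OF assms(3,4)] .
  define X where "X = (*) x ` {- k..k}"
  define Y where "Y = (*) y ` {- l..l}"
  have bounded: "(*) z ` {- j..j} \<subseteq> {- r..r}" if "0 < z" "z * j \<le> r" for z j r :: int
  proof (rule image_subsetI)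
    fix i
    assume "i \<in> {- j..j}"
    then have i: "- j \<le> i" "i \<le> j"
      by simp_all
    have "z * i \<le> z * j" "z * - j \<le> z * i"
      using mult_left_mono[OF i(1)] mult_left_mono[OF i(2)] that(1) by simp_all
    then show "z * i \<in> {- r..r}"
      using that(2) by simp
  qed
  have X: "X \<subseteq> {- p..p}" "0 \<in> X" and Y: "Y \<subseteq> {- q..q}" "0 \<in> Y"
    using bounded x y unfolding X_def Y_def by (auto simp: image_iff)
  have rows: "decomposable {3, 4} (({- p..p} - X) \<times> {- q..q})"
    using decomposable_mono[OF decomposable_times_interval[OF R]] unfolding X_def by simp
  \<comment> \<open>\<open>X\<close> need not be an interval, so the columns are decomposed over
    \<open>{- k..k}\<close>, then exchanged with the rows and stretched by \<open>x\<close>.\<close>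
  have "decomposable {3, 4} (({- q..q} - Y) \<times> {- k..k})"
    using decomposable_mono[OF decomposable_times_interval[OF S]] unfolding Y_def by simp
  then have "decomposable {3, 4} ((\<lambda>(i, j). (x * i, 1 * j)) ` prod.swap ` (({- q..q} - Y) \<times> {- k..k}))"
    using x(1) by (intro decomposable_scale decomposable_swap) simp_all
  moreover have "(\<lambda>(i, j). (x * i, 1 * j)) ` prod.swap ` (({- q..q} - Y) \<times> {- k..k}) = X \<times> ({- q..q} - Y)"
    unfolding product_swap X_def by (force simp: image_iff)
  ultimately have columns: "decomposable {3, 4} (X \<times> ({- q..q} - Y))"
    by simp
  have "decomposable {3, 4} ((\<lambda>(i, j). (x * i, y * j)) ` ({- k..k} \<times> {- l..l} - {(0, 0)}))"
    using x(1,2) y(1,2) by (intro decomposable_scale decomposable_cores) simp_all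
  moreover have "(\<lambda>(i, j). (x * i, y * j)) ` ({- k..k} \<times> {- l..l} - {(0, 0)}) = X \<times> Y - {(0, 0)}"
    unfolding X_def Y_def using x(1) y(1) by (force simp: image_iff)
  ultimately have core: "decomposable {3, 4} (X \<times> Y - {(0, 0)})"
    by simp
  have "decomposable {3, 4} (({- p..p} - X) \<times> {- q..q} \<union> (X \<times> ({- q..q} - Y) \<union> (X \<times> Y - {(0, 0)})))"
    by (intro decomposable_Un rows columns core) auto
  moreover have "({- p..p} - X) \<times> {- q..q} \<union> (X \<times> ({- q..q} - Y) \<union> (X \<times> Y - {(0, 0)})) =
      {- p..p} \<times> {- q..q} - {(0, 0)}"
    using X Y by blast
  ultimately show ?thesis
    by simp
qed

lemma decomposable_grid_mod_3_0:
  fixes p q :: int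
  assumes "0 \<le> p" "p mod 3 = 0" "0 \<le> q" "q mod 3 = 0"
  shows "decomposable {3, 4} ({- p..p} \<times> {- q..q} - {(0, 0)})"
proof -
  have p: "3 * (p div 3) = p" and q: "3 * (q div 3) = q"
    using assms by presburger+
  have P: "decomposable {3, 4} ({- p..p} - {0})"
    using decomposable_interval[of "p div 3"] p assms by simp
  have Q: "decomposable {3, 4} ({- q..q} - {0})"
    using decomposable_interval[of "q div 3"] q assms by simp
  have "decomposable {3, 4} ((\<lambda>x. (x, 0 :: int)) ` ({- p..p} - {0}))"
    by (rule decomposable_image[OF _ _ P]) (auto simp: inj_def)
  moreover have "decomposable {3, 4} ((\<lambda>y. (0 :: int, y)) ` ({- q..q} - {0}))"
    by (rule decomposable_image[OF _ _ Q]) (auto simp: inj_def)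
  moreover have "decomposable {3, 4} (({- p..p} - {0}) \<times> ({- q..q} - {0}))"
    by (rule decomposable_times[OF P Q])
  ultimately have "decomposable {3, 4} ((\<lambda>x. (x, 0 :: int)) ` ({- p..p} - {0}) \<union>
      ((\<lambda>y. (0 :: int, y)) ` ({- q..q} - {0}) \<union> ({- p..p} - {0}) \<times> ({- q..q} - {0})))"
    by (intro decomposable_Un) auto
  moreover have "(\<lambda>x. (x, 0 :: int)) ` ({- p..p} - {0}) \<union>
      ((\<lambda>y. (0 :: int, y)) ` ({- q..q} - {0}) \<union> ({- p..p} - {0}) \<times> ({- q..q} - {0})) =
      {- p..p} \<times> {- q..q} - {(0, 0)}"
    using assms(1,3) by (auto simp: image_iff)
  ultimately show ?thesis
    by simp
qed

section \<open>Difference families\<close>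

lemma inj_on_diff:
  assumes "distinct_diffs B"
  shows "inj_on (\<lambda>(p, q). p - q) {(p, q). p \<in> B \<and> q \<in> B \<and> p \<noteq> q}"
proof (rule inj_onI)
  fix z w
  assume "z \<in> {(p, q). p \<in> B \<and> q \<in> B \<and> p \<noteq> q}" "w \<in> {(p, q). p \<in> B \<and> q \<in> B \<and> p \<noteq> q}"
    and eq: "(case z of (p, q) \<Rightarrow> p - q) = (case w of (p, q) \<Rightarrow> p - q)"
  then obtain x y u v where z: "z = (x, y)" "w = (u, v)"
      and mem: "x \<in> B" "y \<in> B" "u \<in> B" "v \<in> B" and "x \<noteq> y"
    by blast
  have "x - y = u - v"
    using eq unfolding z by simp
  then have "x = u \<and> y = v"
    by (rule distinct_diffsD[OF assms mem \<open>x \<noteq> y\<close>])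
  then show "z = w"
    unfolding z by simp
qed

lemma image_diff: "(\<lambda>(p, q). p - q) ` {(p, q). p \<in> B \<and> q \<in> B \<and> p \<noteq> q} = diffs B"
  unfolding diffs_def by force

lemma differences_eq: "distinct_diffs B \<Longrightarrow> differences B = mset_set (diffs B)"
  unfolding differences_def by (simp add: image_mset_mset_set inj_on_diff image_diff)

lemma diffs_translate: "diffs ((\<lambda>x. x - b) ` B) = diffs B"
proof (intro set_eqI iffI)
  fix d
  assume "d \<in> diffs B"
  then obtain x y where "x \<in> B" "y \<in> B" "x \<noteq> y" and d: "d = (x - b) - (y - b)"
    by (auto elim: diffsE)
  then show "d \<in> diffs ((\<lambda>x. x - b) ` B)"
    unfolding d by (intro diffsI imageI) simp_all
qed (auto elim!: diffsE intro: diffsI)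

lemma distinct_diffs_translate: "distinct_diffs ((\<lambda>x. x - b) ` B) \<longleftrightarrow> distinct_diffs B"
  by (simp add: distinct_diffs_def)

lemma finite_diffs: "finite B \<Longrightarrow> finite (diffs B)"
  by (rule finite_subset[of _ "(\<lambda>(x, y). x - y) ` (B \<times> B)"]) (auto simp: diffs_def)

text \<open>Translation preserves differences, so each nonempty block may be moved to contain 0. Its
  other points are then differences themselves, which keeps the block inside the grid. Finiteness is
  carried along because \<open>mset_set\<close> sends infinite sets to the empty multiset.\<close>

lemma decomposable_family:
  fixes D :: "(int \<times> int) set"
  assumes "decomposable K D"
  shows "finite D \<and> (\<exists>\<B>. (\<forall>B \<in># \<B>. B \<subseteq> insert 0 D \<and> card B \<in> K) \<and> family_differences \<B> = mset_set D)"
  using assms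
proof (induction D)
  case empty
  then show ?case by (auto simp: family_differences_def intro!: exI[of _ "{#}"])
next
  case (block D B)
  then obtain \<B> where \<B>: "\<forall>B \<in># \<B>. B \<subseteq> insert 0 D \<and> card B \<in> K" "family_differences \<B> = mset_set D"
    by blast
  \<comment> \<open>For an empty block \<open>b\<close> is arbitrary, but then \<open>C\<close> is
    empty too.\<close>
  define b where "b = (SOME b. b \<in> B)"
  define C where "C = (\<lambda>x. x - b) ` B"
  have "C \<subseteq> insert 0 (diffs B)"
  proof
    fix z
    assume "z \<in> C"
    then obtain x where x: "x \<in> B" "z = x - b"
      by (auto simp: C_def)
    then have "b \<in> B"
      unfolding b_def by (metis someI)
    then show "z \<in> insert 0 (diffs B)"
      using x by (cases "x = b") (auto intro: diffsI)
  qed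
  moreover have "card C \<in> K"
    unfolding C_def using block.hyps(3) by (simp add: card_image)
  moreover have "family_differences (add_mset C \<B>) = mset_set (diffs B \<union> D)"
    using block differences_eq[of C] \<B>(2)
    by (simp add: family_differences_def C_def diffs_translate distinct_diffs_translate
        finite_diffs mset_set_Union Int_commute)
  moreover from \<B>(1) calculation(1,2)
  have "\<forall>B' \<in># add_mset C \<B>. B' \<subseteq> insert 0 (diffs B \<union> D) \<and> card B' \<in> K"
    by auto
  ultimately show ?case
    using block finite_diffs by blast
qed

lemma generalized_PDF_if_decomposable:
  assumes "decomposable K (centered n \<times> centered m - {(0, 0)})" "odd n" "odd m"
  shows "\<exists>\<B>. generalized_PDF n m K \<B>"
proof -
  have "(0, 0) \<in> centered n \<times> centered m"
    using assms(2,3) by (auto simp: centered_def elim!: oddE)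
  then show ?thesis
    using decomposable_family[OF assms(1)] unfolding generalized_PDF_def zero_prod_def
    by (meson Diff_subset insert_subset order_trans)
qed

section \<open>Counting differences for the necessary condition\<close>

lemma card_centered: "odd n \<Longrightarrow> card (centered n) = n"
  by (auto simp: centered_def elim!: oddE)

lemma size_differences:
  assumes "finite B"
  shows "size (differences B) = card B * card B - card B"
proof -
  have "{(p, q). p \<in> B \<and> q \<in> B \<and> p \<noteq> q} = B \<times> B - (\<lambda>p. (p, p)) ` B"
    by auto
  moreover have "card ((\<lambda>p. (p, p)) ` B) = card B"
    by (rule card_image) (auto simp: inj_on_def)
  ultimately have "card {(p, q). p \<in> B \<and> q \<in> B \<and> p \<noteq> q} = card B * card B - card B"
    using assms by (simp add: card_Diff_subset image_subset_iff card_cartesian_product)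
  then show ?thesis
    unfolding differences_def by simp
qed

text \<open>A block of size 3 or 4 has 6 or 12 ordered differences, and there are
  \<open>n * m - 1\<close> in all.\<close>

lemma generalized_PDF_imp_dvd:
  assumes "generalized_PDF n m {3, 4} \<B>" "odd n" "odd m"
  shows "6 dvd n * m - 1"
proof -
  have "6 dvd size (differences B)" if "card B \<in> {3, 4}" for B
  proof -
    have "finite B"
      using that by (intro card_ge_0_finite) auto
    then show ?thesis
      using that by (auto simp: size_differences)
  qed
  moreover have "\<forall>B \<in># \<B>. card B \<in> {3, 4}"
    using assms(1) unfolding generalized_PDF_def by blast
  ultimately have "6 dvd size (family_differences \<B>)"
    by (induction \<B>) (auto simp: family_differences_def)
  moreover have "(0, 0) \<in> centered n \<times> centered m"
    using assms(2,3) by (auto simp: centered_def elim!: oddE)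
  then have "card (centered n \<times> centered m - {(0, 0)}) = n * m - 1"
    using assms(2,3) by (simp add: card_centered card_cartesian_product)
  ultimately show ?thesis
    using assms(1) unfolding generalized_PDF_def by simp
qed

theorem theorem1p6:
  fixes n m :: nat
  assumes "n > 0" and "m > 0" and "odd n" and "odd m"
  shows "(\<exists>\<B>. generalized_PDF n m {3, 4} \<B>) \<longleftrightarrow> [n * m = 1] (mod 6)"
proof
  assume "\<exists>\<B>. generalized_PDF n m {3, 4} \<B>"
  then obtain \<B> where "generalized_PDF n m {3, 4} \<B>" ..
  then have "6 dvd n * m - 1"
    using assms(3,4) by (rule generalized_PDF_imp_dvd)
  then obtain k where "n * m - 1 = 6 * k"
    by (rule dvdE)
  \<comment> \<open>Positivity rules out truncation in \<open>n * m - 1\<close>.\<close>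
  moreover have "0 < n * m"
    using assms(1,2) by (rule mult_pos_pos)
  ultimately have "n * m = 1 + 6 * k"
    by linarith
  then show "[n * m = 1] (mod 6)"
    unfolding cong_def by (simp only: mod_mult_self2)
next
  assume "[n * m = 1] (mod 6)"
  then have mod: "(n mod 6) * (m mod 6) mod 6 = 1"
    by (simp add: cong_def mod_mult_eq)
  have "k mod 6 = 1 \<or> k mod 6 = 3 \<or> k mod 6 = 5" if "odd k" for k :: nat
    using that by presburger
  note this[OF assms(3)] this[OF assms(4)]
  \<comment> \<open>Modulo 6 the residue 3 is not invertible and 5 is its own inverse.\<close>
  then have cases: "n mod 6 = 1 \<and> m mod 6 = 1 \<or> n mod 6 = 5 \<and> m mod 6 = 5"
    using mod by (elim disjE) simp_all
  define p q where "p = (int n - 1) div 2" and "q = (int m - 1) div 2"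
  have pos: "0 \<le> p" "0 \<le> q"
    using assms(1,2) unfolding p_def q_def by simp_all
  \<comment> \<open>\<open>6 * r + 1\<close> yields the half-width \<open>3 * r\<close>, and
    \<open>6 * r + 5\<close> yields \<open>3 * r + 2\<close>.\<close>
  have mod_3: "k mod 6 = 1 \<Longrightarrow> (int k - 1) div 2 mod 3 = 0" "k mod 6 = 5 \<Longrightarrow> (int k - 1) div 2 mod 3 = 2"
    for k :: nat
    by presburger+
  from cases have "decomposable {3, 4} ({- p..p} \<times> {- q..q} - {(0, 0)})"
  proof (elim disjE conjE)
    assume "n mod 6 = 1" "m mod 6 = 1"
    then show ?thesis
      using pos mod_3(1) unfolding p_def q_def by (intro decomposable_grid_mod_3_0)
  next
    assume "n mod 6 = 5" "m mod 6 = 5"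
    then show ?thesis
      using pos mod_3(2) unfolding p_def q_def by (intro decomposable_grid_mod_3_2)
  qed
  moreover have "centered n = {- p..p}" "centered m = {- q..q}"
    by (simp_all only: centered_def p_def q_def)
  ultimately show "\<exists>\<B>. generalized_PDF n m {3, 4} \<B>"
    using assms(3,4) by (intro generalized_PDF_if_decomposable) simp_all
qed

end
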